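(* Let $d\in\mathbb{Z}_{>0}$ and $\mu\in\Lambda_{\le p^d}$. Let $\theta,\theta'\in\mathrm{Der}_S$ be of the form $\theta=fx^{\mu_1}\partial_x+gy^{\mu_2}\partial_y$ and $\theta'=f'x^{\mu_1}\partial_x+g'y^{\mu_2}\partial_y$ with $f,g,f',g'\in S$. Then the following are equivalent: (i) $\{\theta,\theta'\}$ is a basis for $D(\mathcal{A},\mu)$; (ii) $\{\theta^\vee,\theta'^\vee\}$ is a basis for $D(\mathcal{A},\mu^\vee)$. Furthermore, $\Delta(\mu)=\Delta(\mu^\vee)$.
   Context: Let $p$ be a prime, $\mathbb{F}=\mathbb{F}_p$, $S=\mathbb{F}[x,y]$, $\mathrm{Der}_S=S\partial_x\oplus S\partial_y$. Let $\mathcal{A}=\{H_1,H_2,H_3\}$ with $H_1=\ker x$, $H_2=\ker y$, $H_3=\ker(x+y)$, $\alpha_1=x,\alpha_2=y,\alpha_3=x+y$. For $\mu=(\mu_1,\mu_2,\mu_3)\in\Lambda\coloneqq\mathbb{Z}_{\ge0}^3$, $D(\mathcal{A},\mu)=\{\theta\in\mathrm{Der}_S:\theta(\alpha_i)\in\alpha_i^{\mu_i}S,\ i=1,2,3\}$; it is a free $S$-module of rank 2 with a homogeneous basis whose degrees (the exponents) are unique up to order; $\Delta(\mu)$ is the absolute difference of the two exponents. $\Lambda_{\le p^d}=\{\mu\in\Lambda:\mu_1,\mu_2,\mu_3\le p^d\}$, and for $\mu\in\Lambda_{\le p^d}$, $\mu^\vee=(p^d-\mu_1,\,p^d-\mu_2,\,\mu_3)$.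 For $\theta=fx^{\mu_1}\partial_x+gy^{\mu_2}\partial_y$ ($f,g\in S$), define $\theta^\vee=gx^{p^d-\mu_1}\partial_x-fy^{p^d-\mu_2}\partial_y$. *)

theory Defs
  imports
    "Berlekamp_Zassenhaus.Finite_Field"
    "HOL-Library.Function_Algebras"
begin

text \<open>
  \<open>S = k[x, y]\<close> is the iterated polynomial ring \<open>(k[x])[y]\<close>: the variable of the outer
  polynomial is \<open>y\<close>, that of its coefficients is \<open>x\<close>.  The definitions are made over
  an arbitrary field; the prime field with \<open>p\<close> elements is \<open>'p mod_ring\<close>, where
  \<open>p = CARD('p)\<close>.
\<close>

type_synonym 'k S = "'k poly poly"

definition X :: "'k::field S" where
  "X = [:[:0, 1:]:]"

definition Y :: "'k::field S" where
  "Y = [:0, 1:]"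

definition d_x :: "'k::field S \<Rightarrow> 'k S" where
  "d_x h = map_poly pderiv h"

definition d_y :: "'k::field S \<Rightarrow> 'k S" where
  "d_y h = pderiv h"

definition scale_der :: "'k::field S \<Rightarrow> ('k S \<Rightarrow> 'k S) \<Rightarrow> ('k S \<Rightarrow> 'k S)" where
  "scale_der s \<theta> = (\<lambda>h. s * \<theta> h)"

text \<open>
  All maps from \<open>S\<close> to itself, with pointwise operations, form an \<open>S\<close>-module;
  the derivation module and the modules of logarithmic derivations are submodules of it.
\<close>

interpretation der: Modules.module "scale_der :: 'k::field S \<Rightarrow> ('k S \<Rightarrow> 'k S) \<Rightarrow> ('k S \<Rightarrow> 'k S)"
  by unfold_locales
    (auto simp: scale_der_def fun_eq_iff algebra_simps)

definition der_of :: "'k::field S \<Rightarrow> 'k S \<Rightarrow> ('k S \<Rightarrow> 'k S)" where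
  "der_of a b = scale_der a d_x + scale_der b d_y"

definition Der :: "('k::field S \<Rightarrow> 'k S) set" where
  "Der = {der_of a b | a b. True}"

definition D :: "nat \<times> nat \<times> nat \<Rightarrow> ('k::field S \<Rightarrow> 'k S) set" where
  "D = (\<lambda>(m1, m2, m3). {\<theta> \<in> Der.
     X ^ m1 dvd \<theta> X \<and> Y ^ m2 dvd \<theta> Y \<and> (X + Y) ^ m3 dvd \<theta> (X + Y)})"

definition is_basis :: "('k::field S \<Rightarrow> 'k S) set \<Rightarrow> ('k S \<Rightarrow> 'k S) set \<Rightarrow> bool" where
  "is_basis B M \<longleftrightarrow> der.independent B \<and> der.span B = M"

text \<open>
  Homogeneity of polynomials is with respect to the total degree, and the degree of a homogeneous
  derivation is the common degree of its two coefficients.  Zero is homogeneous of every degree.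
\<close>

definition homogeneous :: "nat \<Rightarrow> 'k::field S \<Rightarrow> bool" where
  "homogeneous n h \<longleftrightarrow> (\<forall>i j. coeff (coeff h j) i \<noteq> 0 \<longrightarrow> i + j = n)"

definition homogeneous_der :: "nat \<Rightarrow> ('k::field S \<Rightarrow> 'k S) \<Rightarrow> bool" where
  "homogeneous_der n \<theta> \<longleftrightarrow>
     (\<exists>a b. homogeneous n a \<and> homogeneous n b \<and> \<theta> = der_of a b)"

text \<open>
  \<open>d1\<close> and \<open>d2\<close> are the exponents of a homogeneous basis.  Such a basis exists,
  and its exponents are unique up to order, for every multiplicity.  The field, which occurs
  neither in the multiplicity nor in the result, is passed as a type argument.
\<close>

definition Delta :: "'k::field itself \<Rightarrow> nat \<times> nat \<times> nat \<Rightarrow> nat" where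
  "Delta _ \<mu> = (THE n. \<exists>(\<theta>1 :: 'k S \<Rightarrow> 'k S) \<theta>2 d1 d2.
     \<theta>1 \<noteq> \<theta>2 \<and> homogeneous_der d1 \<theta>1 \<and> homogeneous_der d2 \<theta>2 \<and>
     is_basis {\<theta>1, \<theta>2} (D \<mu>) \<and> int n = \<bar>int d1 - int d2\<bar>)"

definition Lambda_le :: "nat \<Rightarrow> (nat \<times> nat \<times> nat) set" where
  "Lambda_le q = {(m1, m2, m3). m1 \<le> q \<and> m2 \<le> q \<and> m3 \<le> q}"

definition mult_dual :: "nat \<Rightarrow> nat \<times> nat \<times> nat \<Rightarrow> nat \<times> nat \<times> nat" where
  "mult_dual q = (\<lambda>(m1, m2, m3). (q - m1, q - m2, m3))"

definition der_form :: "nat \<times> nat \<times> nat \<Rightarrow> 'k::field S \<Rightarrow> 'k S \<Rightarrow> ('k S \<Rightarrow> 'k S)" where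
  "der_form = (\<lambda>(m1, m2, m3) f g. der_of (f * X ^ m1) (g * Y ^ m2))"

text \<open>
  The dual of the derivation \<open>der_form \<mu> f g\<close>, given through \<open>f\<close> and \<open>g\<close>,
  which are determined by \<open>\<mu>\<close> and the derivation.
\<close>

definition der_dual :: "nat \<Rightarrow> nat \<times> nat \<times> nat \<Rightarrow> 'k::field S \<Rightarrow> 'k S \<Rightarrow> ('k S \<Rightarrow> 'k S)" where
  "der_dual q = (\<lambda>(m1, m2, m3) f g. der_of (g * X ^ (q - m1)) (- (f * Y ^ (q - m2))))"

end

theory Submission
  imports Defs "HOL-Library.Product_Plus"
begin

text \<open>
  The assignment \<open>(f, g) \<mapsto> f x\<^bsup>\<mu>\<^sub>1\<^esup> \<partial>\<^sub>x + g y\<^bsup>\<mu>\<^sub>2\<^esup> \<partial>\<^sub>y\<close> is \<open>S\<close>-linear and injective on \<open>S\<^sup>2\<close>, and so is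
  \<open>(f, g) \<mapsto> g x\<^bsup>q - \<mu>\<^sub>1\<^esup> \<partial>\<^sub>x - f y\<^bsup>q - \<mu>\<^sub>2\<^esup> \<partial>\<^sub>y\<close> for \<open>q = p\<^bsup>d\<^esup>\<close>.  Both carry the same submodule of \<open>S\<^sup>2\<close> onto
  \<open>D(\<mu>)\<close> and \<open>D(\<mu>\<^sup>\<or>)\<close> respectively, because \<open>(x + y)\<^bsup>q\<^esup> = x\<^bsup>q\<^esup> + y\<^bsup>q\<^esup>\<close> gives
  \<open>x\<^bsup>\<mu>\<^sub>1\<^esup> y\<^bsup>\<mu>\<^sub>2\<^esup> (g x\<^bsup>q - \<mu>\<^sub>1\<^esup> - f y\<^bsup>q - \<mu>\<^sub>2\<^esup>) = x\<^bsup>q\<^esup> (f x\<^bsup>\<mu>\<^sub>1\<^esup> + g y\<^bsup>\<mu>\<^sub>2\<^esup>) - f x\<^bsup>\<mu>\<^sub>1\<^esup> (x + y)\<^bsup>q\<^esup>\<close> and \<open>x\<close>, \<open>y\<close> are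
  coprime to \<open>x + y\<close>.  So bases correspond to bases, and the degree of a nonzero homogeneous
  element changes by the constant \<open>q - \<mu>\<^sub>1 - \<mu>\<^sub>2\<close>.
\<close>

definition scale_pair :: "'a::comm_ring_1 \<Rightarrow> 'a \<times> 'a \<Rightarrow> 'a \<times> 'a" where
  "scale_pair s = (\<lambda>(a, b). (s * a, s * b))"

interpretation pair: Modules.module "scale_pair :: 'a::comm_ring_1 \<Rightarrow> 'a \<times> 'a \<Rightarrow> 'a \<times> 'a"
  by unfold_locales (auto simp: scale_pair_def algebra_simps)

lemma (in module_hom) inj_independent_image_iff:
  assumes "inj f"
  shows "m2.independent (f ` B) \<longleftrightarrow> m1.independent B"
proof
  assume "m2.independent (f ` B)"
  show "m1.independent B"
  proof
    assume "m1.dependent B"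
    then obtain t u v where t: "finite t" "t \<subseteq> B" "v \<in> t" "u v \<noteq> 0" "(\<Sum>v\<in>t. u v *a v) = 0"
      unfolding m1.dependent_explicit by blast
    \<comment> \<open>The relation on \<open>t\<close> is pushed forward; \<open>the_inv f\<close>
      carries its coefficients to the points of the image.\<close>
    have "(\<Sum>w\<in>f ` t. u (the_inv f w) *b w) = (\<Sum>v\<in>t. f (u v *a v))"
      using assms by (simp add: sum.reindex inj_on_subset[OF assms] scale the_inv_f_f)
    also have "\<dots> = 0"
      using t(5) by (metis sum zero)
    finally have "m2.dependent (f ` B)"
      unfolding m2.dependent_explicit using t assms
      by (intro exI[of _ "f ` t"] exI[of _ "\<lambda>w. u (the_inv f w)"]) (auto simp: the_inv_f_f)
    with \<open>m2.independent (f ` B)\<close> show False by blast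
  qed
qed (use assms independent_inj_image in blast)

text \<open>The right-hand side does not mention \<open>L\<close>, so two such maps with the same
  \<open>B\<close> and \<open>N\<close> can be compared through it.\<close>

lemma is_basis_image_iff:
  fixes L :: "'k::field S \<times> 'k S \<Rightarrow> 'k S \<Rightarrow> 'k S"
  assumes "module_hom scale_pair scale_der L" "inj L"
  shows "is_basis (L ` B) (L ` N) \<longleftrightarrow> pair.independent B \<and> pair.span B = N"
proof -
  interpret L: module_hom scale_pair scale_der L by fact
  show ?thesis
    unfolding is_basis_def
    by (simp add: L.inj_independent_image_iff[OF assms(2)] L.span_image inj_image_eq_iff[OF assms(2)])
qed

lemma d_x_X [simp]: "d_x X = 1" and d_x_Y [simp]: "d_x Y = 0"
  and d_y_X [simp]: "d_y X = 0" and d_y_Y [simp]: "d_y Y = 1"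
  by (simp_all add: d_x_def d_y_def X_def Y_def map_poly_pCons pderiv_pCons one_pCons)

lemma d_x_add: "d_x (a + b) = d_x a + d_x b" and d_y_add: "d_y (a + b) = d_y a + d_y b"
  by (simp_all add: d_x_def d_y_def pderiv_add poly_eq_iff coeff_map_poly)

lemma der_of_X [simp]: "der_of a b X = a"
  and der_of_Y [simp]: "der_of a b Y = b"
  and der_of_X_plus_Y [simp]: "der_of a b (X + Y) = a + b"
  by (simp_all add: der_of_def scale_der_def d_x_add d_y_add)

lemma der_of_eq_iff: "der_of a b = der_of a' b' \<longleftrightarrow> a = a' \<and> b = b'"
  by (metis der_of_X der_of_Y)

lemma X_nonzero [simp]: "(X :: 'k::field S) \<noteq> 0" and Y_nonzero [simp]: "(Y :: 'k S) \<noteq> 0"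
  by (simp_all add: X_def Y_def)

lemma module_hom_der_of:
  "module_hom scale_pair scale_der (\<lambda>(f, g). der_of (f * u) (g * v))"
  "module_hom scale_pair scale_der (\<lambda>(f, g). der_of (g * u) (- (f * v)))"
  by (unfold_locales, auto simp: scale_pair_def scale_der_def der_of_def fun_eq_iff algebra_simps)

lemma module_hom_der_form: "module_hom scale_pair scale_der (\<lambda>(f, g). der_form \<mu> f g)"
  and module_hom_der_dual: "module_hom scale_pair scale_der (\<lambda>(f, g). der_dual q \<mu> f g)"
  by (cases \<mu>, simp add: der_form_def der_dual_def module_hom_der_of)+

lemma inj_der_form: "inj (\<lambda>(f, g). der_form \<mu> f g)"
  and inj_der_dual: "inj (\<lambda>(f, g). der_dual q \<mu> f g)"
  by (cases \<mu>, auto simp: der_form_def der_dual_def inj_def der_of_eq_iff)+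

definition form_module :: "nat \<times> nat \<times> nat \<Rightarrow> ('k::field S \<times> 'k S) set" where
  "form_module = (\<lambda>(m1, m2, m3). {(f, g). (X + Y) ^ m3 dvd f * X ^ m1 + g * Y ^ m2})"

text \<open>The factors \<open>X ^ m1\<close> and \<open>Y ^ m2\<close> already encode the
  conditions at x and y; only the one at x + y is left to constrain the pair (f, g).\<close>

lemma D_eq_image_form_module: "D \<mu> = (\<lambda>(f, g). der_form \<mu> f g) ` form_module \<mu>"
  by (cases \<mu>)
    (auto simp: D_def Der_def form_module_def der_form_def image_iff der_of_eq_iff dvd_def mult.commute)

text \<open>As a polynomial in y over k[x], x + y is monic linear with root -x. A factor not
  vanishing there has order 0 at that root, and orders add over a domain.\<close>

lemma X_plus_Y_power_dvd_mult_iff: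
  fixes u :: "'k::field S"
  assumes "poly u [:0, -1:] \<noteq> 0"
  shows "(X + Y) ^ m dvd u * h \<longleftrightarrow> (X + Y) ^ m dvd h"
proof -
  define a :: "'k poly" where "a = [:0, -1:]"
  have "(X + Y :: 'k S) = [:- a, 1:]" by (simp add: X_def Y_def a_def)
  moreover have "u \<noteq> 0" "order a u = 0" using assms order_0I[of u a] by (auto simp: a_def)
  ultimately show ?thesis
    using order_mult[of u h a] by (cases "h = 0") (simp_all add: order_divides)
qed

lemma poly_X: "poly X a = [:0, 1:]" and poly_Y: "poly Y a = a"
  by (simp_all add: X_def Y_def)

lemma form_module_iff_dual:
  fixes f g :: "'k::field S"
  assumes q: "(X + Y :: 'k S) ^ q = X ^ q + Y ^ q" and le: "m1 \<le> q" "m2 \<le> q" "m3 \<le> q"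
  shows "(X + Y) ^ m3 dvd f * X ^ m1 + g * Y ^ m2
    \<longleftrightarrow> (X + Y) ^ m3 dvd g * X ^ (q - m1) - f * Y ^ (q - m2)"
proof -
  have "X ^ q = (X ^ m1 * X ^ (q - m1) :: 'k S)" "Y ^ q = (Y ^ m2 * Y ^ (q - m2) :: 'k S)"
    using le by (simp_all flip: power_add)
  then have "(X ^ m1 * Y ^ m2) * (g * X ^ (q - m1) - f * Y ^ (q - m2))
      = X ^ q * (f * X ^ m1 + g * Y ^ m2) - f * X ^ m1 * (X + Y) ^ q"
    unfolding q by (simp only: algebra_simps)
  moreover have "(X + Y) ^ m3 dvd f * X ^ m1 * (X + Y) ^ q"
    using le(3) by (simp add: le_imp_power_dvd)
  ultimately have "(X + Y) ^ m3 dvd X ^ q * (f * X ^ m1 + g * Y ^ m2)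
      \<longleftrightarrow> (X + Y) ^ m3 dvd (X ^ m1 * Y ^ m2) * (g * X ^ (q - m1) - f * Y ^ (q - m2))"
    by (metis dvd_diff_left_iff)
  \<comment> \<open>\<open>X ^ q\<close> and \<open>X ^ m1 * Y ^ m2\<close> cancel: at y = -x they
    are powers of x up to sign.\<close>
  then show ?thesis
    by (simp add: X_plus_Y_power_dvd_mult_iff poly_X poly_Y)
qed

lemma D_mult_dual_eq_image_form_module:
  assumes "(X + Y :: 'k::field S) ^ q = X ^ q + Y ^ q" "\<mu> \<in> Lambda_le q"
  shows "(D (mult_dual q \<mu>) :: ('k S \<Rightarrow> 'k S) set)
    = (\<lambda>(f, g). der_dual q \<mu> f g) ` form_module \<mu>"
proof -
  obtain m1 m2 m3 where \<mu>: "\<mu> = (m1, m2, m3)" by (cases \<mu>)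
  \<comment> \<open>Dualizing is the rotation (f, g) to (g, -f) followed by the form map of the dual
    multiplicity, so the description of \<open>D\<close> above applies again.\<close>
  have dual: "der_dual q \<mu> f g = der_form (mult_dual q \<mu>) g (- f)" for f g :: "'k S"
    by (simp add: \<mu> der_dual_def der_form_def mult_dual_def)
  have mem: "(g, - f) \<in> form_module (mult_dual q \<mu>) \<longleftrightarrow> (f, g) \<in> form_module \<mu>" for f g :: "'k S"
    using assms(2) form_module_iff_dual[OF assms(1), of m1 m2 m3 f g]
    by (simp add: \<mu> form_module_def mult_dual_def Lambda_le_def)
  have "(form_module (mult_dual q \<mu>) :: ('k S \<times> 'k S) set) = (\<lambda>(f, g). (g, - f)) ` form_module \<mu>"
  proof (intro equalityI subsetI)
    fix v :: "'k S \<times> 'k S"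
    assume "v \<in> form_module (mult_dual q \<mu>)"
    then show "v \<in> (\<lambda>(f, g). (g, - f)) ` form_module \<mu>"
      using mem[of "fst v" "- snd v"] by (intro image_eqI[of _ _ "(- snd v, fst v)"]) auto
  qed (use mem in auto)
  then show ?thesis
    by (simp add: D_eq_image_form_module image_image dual case_prod_unfold)
qed

lemma is_basis_dual_iff:
  fixes f g f' g' :: "'k::field S"
  assumes "(X + Y :: 'k S) ^ q = X ^ q + Y ^ q" "\<mu> \<in> Lambda_le q"
  shows "is_basis {der_form \<mu> f g, der_form \<mu> f' g'} (D \<mu>) \<longleftrightarrow>
    is_basis {der_dual q \<mu> f g, der_dual q \<mu> f' g'} (D (mult_dual q \<mu>))"
  using is_basis_image_iff[OF module_hom_der_form[of \<mu>] inj_der_form, of "{(f, g), (f', g')}" "form_module \<mu>"]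
    is_basis_image_iff[OF module_hom_der_dual[of q \<mu>] inj_der_dual, of "{(f, g), (f', g')}" "form_module \<mu>"]
  by (simp add: D_eq_image_form_module[of \<mu>] D_mult_dual_eq_image_form_module[OF assms])

lemma coeff_mult_X: "coeff (coeff (h * X) j) i = (case i of 0 \<Rightarrow> 0 | Suc i \<Rightarrow> coeff (coeff h j) i)"
  by (simp add: X_def coeff_pCons mult.commute[of h] split: nat.split)

lemma coeff_mult_Y: "coeff (h * Y) j = (case j of 0 \<Rightarrow> 0 | Suc j \<Rightarrow> coeff h j)"
  by (simp add: Y_def coeff_pCons mult.commute[of h] split: nat.split)

lemma homogeneous_zero [simp]: "homogeneous n 0"
  by (simp add: homogeneous_def)

text \<open>Zero is homogeneous of every degree, hence the separate case.\<close>

lemma homogeneous_mult_X: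
  "homogeneous n (h * X) \<longleftrightarrow> h = 0 \<or> (\<exists>k. n = Suc k \<and> homogeneous k h)" (is ?X)
  and homogeneous_mult_Y:
  "homogeneous n (h * Y) \<longleftrightarrow> h = 0 \<or> (\<exists>k. n = Suc k \<and> homogeneous k h)" (is ?Y)
proof -
  have "homogeneous n (h * X) \<longleftrightarrow> (\<forall>i j. coeff (coeff h j) i \<noteq> 0 \<longrightarrow> Suc (i + j) = n)"
    unfolding homogeneous_def coeff_mult_X by (auto split: nat.split)
  moreover have "homogeneous n (h * Y) \<longleftrightarrow> (\<forall>i j. coeff (coeff h j) i \<noteq> 0 \<longrightarrow> Suc (i + j) = n)"
    unfolding homogeneous_def coeff_mult_Y by (auto split: nat.split)
  moreover have "(\<forall>i j. coeff (coeff h j) i \<noteq> 0 \<longrightarrow> Suc (i + j) = n)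
      \<longleftrightarrow> h = 0 \<or> (\<exists>k. n = Suc k \<and> homogeneous k h)"
    by (cases n) (auto simp: homogeneous_def poly_eq_iff)
  ultimately show ?X ?Y by simp_all
qed

lemma homogeneous_mult_X_power:
  "homogeneous n (h * X ^ m) \<longleftrightarrow> h = 0 \<or> (\<exists>k. n = k + m \<and> homogeneous k h)"
  by (induction m arbitrary: n)
    (auto simp: homogeneous_mult_X mult.assoc[symmetric] power_Suc2 simp del: power_Suc)

lemma homogeneous_mult_Y_power:
  "homogeneous n (h * Y ^ m) \<longleftrightarrow> h = 0 \<or> (\<exists>k. n = k + m \<and> homogeneous k h)"
  by (induction m arbitrary: n)
    (auto simp: homogeneous_mult_Y mult.assoc[symmetric] power_Suc2 simp del: power_Suc)

lemma homogeneous_uminus [simp]: "homogeneous n (- h) \<longleftrightarrow> homogeneous n h"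
  by (simp add: homogeneous_def)

lemma homogeneous_der_of [simp]: "homogeneous_der n (der_of a b) \<longleftrightarrow> homogeneous n a \<and> homogeneous n b"
  by (auto simp: homogeneous_der_def der_of_eq_iff)

text \<open>The shift q - m1 - m2 may be negative, so it is stated additively.\<close>

lemma homogeneous_der_dual:
  assumes "homogeneous_der n (der_form (m1, m2, m3) f g)" "der_form (m1, m2, m3) f g \<noteq> 0"
    and "m1 \<le> q" "m2 \<le> q"
  shows "\<exists>n'. n' + m1 + m2 = n + q \<and> homogeneous_der n' (der_dual q (m1, m2, m3) f g)"
proof (intro exI conjI)
  have "f \<noteq> 0 \<or> g \<noteq> 0"
    using assms(2) by (auto simp: der_form_def der_of_def scale_der_def fun_eq_iff)
  \<comment> \<open>If f is nonzero then m1 \<le> n, and m2 \<le> q; symmetrically for g. So the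
    subtraction is not truncated.\<close>
  then show "n + q - m1 - m2 + m1 + m2 = n + q"
    using assms by (auto simp: der_form_def homogeneous_mult_X_power homogeneous_mult_Y_power)
  show "homogeneous_der (n + q - m1 - m2) (der_dual q (m1, m2, m3) f g)"
    using assms(1,3,4)
    by (auto simp: der_form_def der_dual_def homogeneous_mult_X_power homogeneous_mult_Y_power)
qed

definition is_exponent_difference :: "'k::field itself \<Rightarrow> nat \<times> nat \<times> nat \<Rightarrow> nat \<Rightarrow> bool" where
  "is_exponent_difference _ \<mu> n \<longleftrightarrow> (\<exists>(\<theta>1 :: 'k S \<Rightarrow> 'k S) \<theta>2 d1 d2.
     \<theta>1 \<noteq> \<theta>2 \<and> homogeneous_der d1 \<theta>1 \<and> homogeneous_der d2 \<theta>2 \<and>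
     is_basis {\<theta>1, \<theta>2} (D \<mu>) \<and> int n = \<bar>int d1 - int d2\<bar>)"

lemma is_exponent_difference_dual:
  assumes q: "(X + Y :: 'k::field S) ^ q = X ^ q + Y ^ q" and \<mu>: "\<mu> \<in> Lambda_le q"
    and "is_exponent_difference TYPE('k) \<mu> n"
  shows "is_exponent_difference TYPE('k) (mult_dual q \<mu>) n"
proof -
  obtain \<theta>1 \<theta>2 :: "'k S \<Rightarrow> 'k S" and d1 d2 where \<theta>: "\<theta>1 \<noteq> \<theta>2"
      "homogeneous_der d1 \<theta>1" "homogeneous_der d2 \<theta>2"
      and basis: "is_basis {\<theta>1, \<theta>2} (D \<mu>)" and n: "int n = \<bar>int d1 - int d2\<bar>"
    using assms(3) unfolding is_exponent_difference_def by blast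
  have "\<theta>1 \<in> D \<mu>" "\<theta>2 \<in> D \<mu>"
    using basis der.span_superset[of "{\<theta>1, \<theta>2}"] by (auto simp: is_basis_def)
  then obtain f g f' g' where form: "\<theta>1 = der_form \<mu> f g" "\<theta>2 = der_form \<mu> f' g'"
    unfolding D_eq_image_form_module by auto
  have nonzero: "\<theta>1 \<noteq> 0" "\<theta>2 \<noteq> 0"
    using basis der.dependent_zero[of "{\<theta>1, \<theta>2}"] by (auto simp: is_basis_def)
  obtain m1 m2 m3 where m: "\<mu> = (m1, m2, m3)" by (cases \<mu>)
  then have le: "m1 \<le> q" "m2 \<le> q" using \<mu> by (auto simp: Lambda_le_def)
  obtain d1' where d1': "d1' + m1 + m2 = d1 + q" "homogeneous_der d1' (der_dual q \<mu> f g)"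
    using homogeneous_der_dual[of d1 m1 m2 m3 f g q] \<theta>(2) nonzero(1) form le m by blast
  obtain d2' where d2': "d2' + m1 + m2 = d2 + q" "homogeneous_der d2' (der_dual q \<mu> f' g')"
    using homogeneous_der_dual[of d2 m1 m2 m3 f' g' q] \<theta>(3) nonzero(2) form le m by blast
  have "der_dual q \<mu> f g \<noteq> der_dual q \<mu> f' g'"
    using \<theta>(1) form inj_der_dual[of q \<mu>] unfolding inj_def by auto
  moreover have "is_basis {der_dual q \<mu> f g, der_dual q \<mu> f' g'} (D (mult_dual q \<mu>))"
    using basis is_basis_dual_iff[OF q \<mu>] form by blast
  \<comment> \<open>Both degrees move by the same shift, which cancels.\<close>
  moreover have "int n = \<bar>int d1' - int d2'\<bar>"
    using n d1'(1) d2'(1) by linarith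
  ultimately show ?thesis
    unfolding is_exponent_difference_def using d1'(2) d2'(2) by blast
qed

text \<open>Both \<open>THE\<close> descriptions have equivalent predicates: one implication is the
  previous lemma, the other follows because \<open>mult_dual q\<close> is an involution on
  \<open>Lambda_le q\<close>.\<close>

lemma Delta_dual:
  assumes q: "(X + Y :: 'k::field S) ^ q = X ^ q + Y ^ q" and \<mu>: "\<mu> \<in> Lambda_le q"
  shows "Delta TYPE('k) \<mu> = Delta TYPE('k) (mult_dual q \<mu>)"
proof -
  have "mult_dual q \<mu> \<in> Lambda_le q" "mult_dual q (mult_dual q \<mu>) = \<mu>"
    using \<mu> by (auto simp: Lambda_le_def mult_dual_def)
  then have "is_exponent_difference TYPE('k) \<mu> n
      \<longleftrightarrow> is_exponent_difference TYPE('k) (mult_dual q \<mu>) n" for n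
    using is_exponent_difference_dual[OF q] \<mu> by metis
  then show ?thesis
    unfolding Delta_def is_exponent_difference_def by simp
qed

lemma CHAR_mod_ring: "CHAR('p::prime_card mod_ring) = CARD('p)"
proof -
  have "CHAR('p mod_ring) dvd CARD('p)"
    by (metis of_nat_card_eq_0 of_nat_eq_0_iff_char_dvd)
  then show ?thesis
    using prime_card[where 'a = 'p] CHAR_not_1'[where 'a = "'p mod_ring"]
    by (auto simp: prime_nat_iff)
qed

theorem theorem4p5:
  fixes d :: nat and \<mu> :: "nat \<times> nat \<times> nat"
    and f g f' g' :: "'p::prime_card mod_ring S"
    and \<theta> \<theta>' :: "'p mod_ring S \<Rightarrow> 'p mod_ring S"
  assumes "d > 0"
    and "\<mu> \<in> Lambda_le (CARD('p) ^ d)"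
    and "\<theta> = der_form \<mu> f g"
    and "\<theta>' = der_form \<mu> f' g'"
  shows "(is_basis {\<theta>, \<theta>'} (D \<mu>) \<longleftrightarrow>
      is_basis {der_dual (CARD('p) ^ d) \<mu> f g, der_dual (CARD('p) ^ d) \<mu> f' g'}
        (D (mult_dual (CARD('p) ^ d) \<mu>)))
    \<and> Delta TYPE('p mod_ring) \<mu> = Delta TYPE('p mod_ring) (mult_dual (CARD('p) ^ d) \<mu>)"
proof -
  \<comment> \<open>Only here does q become a power of p; S inherits its characteristic from the
    coefficient field.\<close>
  have "(X + Y :: 'p mod_ring S) ^ (CARD('p) ^ d) = X ^ (CARD('p) ^ d) + Y ^ (CARD('p) ^ d)"
    by (rule freshmans_dream') (simp_all add: CHAR_mod_ring prime_card)
  then show ?thesis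
    using assms(2) is_basis_dual_iff Delta_dual unfolding assms(3,4) by blast
qed

end
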